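(* For $r\ge1$ let $\sigma_r:=\sqrt{\mathrm{Var}(\mu^{(r)})}>0$ and let $\widetilde\mu^{(r)}$ be the probability measure on $\mathbb{R}$ supported on $\{d/\sigma_r:d\in\mathbb{Z}\}$ with $\widetilde\mu^{(r)}(\{d/\sigma_r\})=\mu^{(r)}(d)$ for all $d\in\mathbb{Z}$. Then $\widetilde\mu^{(r)}$ converges in distribution to the standard normal law $\mathcal{N}(0,1)$ as $\rho(r)\to\infty$; that is, for every sequence of integers $r_n\ge1$ with $\rho(r_n)\to\infty$, $\widetilde\mu^{(r_n)}\to\mathcal{N}(0,1)$ in distribution.
   Context: Fix an integer $b\ge 2$. Every $n\in\mathbb{N}$ has a unique base-$b$ expansion $n=\sum_{k\ge0}n_kb^k$ with digits in $\{0,\dots,b-1\}$; $s(n):=\sum_k n_k$. For $r,n\in\mathbb{N}$ put $\Delta^{(r)}(n):=s(n+r)-s(n)$, and for $d\in\mathbb{Z}$, $\mu^{(r)}(d):=\lim_{N\to\infty}\frac1N|\{n<N:\Delta^{(r)}(n)=d\}|$; these limits exist and define a probability measure on $\mathbb{Z}$ with finite moments, and $\mathrm{Var}(\mu^{(r)})>0$ for $r\ge1$. Blocks: write the expansion of $r\ge1$ as the digit string $r_\ell\cdots r_0$ with $r_\ell\ne0$. A block is either a maximal run of consecutive $0$ digits, or a maximal run of consecutive digits equal to $b-1$, or (when $b\ge3$) a single digit with value in $\{1,\dots,b-2\}$. $\rho(r)$ is the number of blocks of $r$. *)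

theory Defs
  imports "HOL-Probability.Probability"
begin

function dsum :: "nat \<Rightarrow> nat \<Rightarrow> nat" where
  "dsum b n = (if b \<le> 1 \<or> n = 0 then 0 else n mod b + dsum b (n div b))"
  by pat_completeness auto
termination by (relation "Wellfounded.measure snd") auto

function digits :: "nat \<Rightarrow> nat \<Rightarrow> nat list" where
  "digits b n = (if b \<le> 1 \<or> n = 0 then [] else n mod b # digits b (n div b))"
  by pat_completeness auto
termination by (relation "Wellfounded.measure snd") auto

definition Delta :: "nat \<Rightarrow> nat \<Rightarrow> nat \<Rightarrow> int" where
  "Delta b r n = int (dsum b (n + r)) - int (dsum b n)"

definition mu :: "nat \<Rightarrow> nat \<Rightarrow> int \<Rightarrow> real" where
  "mu b r d = lim (\<lambda>N. real (card {n. n < N \<and> Delta b r n = d}) / real N)"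

definition Var_mu :: "nat \<Rightarrow> nat \<Rightarrow> real" where
  "Var_mu b r = (\<Sum>\<^sub>\<infinity>d\<in>UNIV. (real_of_int d)\<^sup>2 * mu b r d)
               - (\<Sum>\<^sub>\<infinity>d\<in>UNIV. real_of_int d * mu b r d)\<^sup>2"

definition sigma :: "nat \<Rightarrow> nat \<Rightarrow> real" where
  "sigma b r = sqrt (Var_mu b r)"

definition mu_tilde :: "nat \<Rightarrow> nat \<Rightarrow> real measure" where
  "mu_tilde b r = distr (density (count_space UNIV) (\<lambda>d::int. ennreal (mu b r d))) borel
                        (\<lambda>d. real_of_int d / sigma b r)"

definition dclass :: "nat \<Rightarrow> nat \<Rightarrow> nat" where
  "dclass b c = (if c = 0 then 0 else if c = b - 1 then 1 else 2)"

text \<open>rho(r): number of blocks. A new block starts at position i if i is the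
  first position, or the class changes, or the digit is a middle digit
  (each middle digit is its own block).\<close>
definition rho :: "nat \<Rightarrow> nat \<Rightarrow> nat" where
  "rho b r = (let ds = digits b r in
     card {i. i < length ds \<and> (i = 0 \<or> dclass b (ds ! i) \<noteq> dclass b (ds ! (i - 1))
                                   \<or> dclass b (ds ! i) = 2)})"

end

theory Submission
  imports Defs
begin

text \<open>
  Splitting off the last digit, \<open>n = b m + a\<close> and \<open>r = b q + c\<close>, gives with probability \<open>(b - c) / b\<close>
  (no carry) \<open>\<Delta>\<^sup>r(n) = \<Delta>\<^sup>q(m) + c\<close> and with probability \<open>c / b\<close> (carry)
  \<open>\<Delta>\<^sup>r(n) = \<Delta>\<^bsup>q+1\<^esup>(m) + c - b\<close>. Hence all the measures are centred, and their variances
  \<open>V\<close> satisfy \<open>V(b q + c) = ((b - c) V(q) + c V(q + 1)) / b + c (b - c)\<close>; in particular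
  \<open>|V(q + 1) - V(q)| \<le> b\<close>. The Gaussian \<open>exp(-t\<^sup>2 V(r) / 2)\<close> satisfies the recursion of the
  characteristic function up to an error \<open>O(|t|\<^sup>3)\<close>, which vanishes for \<open>c = 0\<close>. Since
  \<open>c (b - c) \<ge> 1\<close> for \<open>c > 0\<close>, the accumulated error obeys a recursion dominated by that of \<open>V\<close>, so
  the characteristic function differs from the Gaussian by at most \<open>K |t|\<^sup>3 V(r)\<close>. After rescaling
  \<open>t\<close> by the standard deviation this is \<open>O(V(r) powr (-1/2))\<close>, and Levy's continuity theorem applies
  because \<open>V(r) \<ge> \<rho>(r) / 2 - 1\<close>.
\<close>

subsection \<open>Natural density\<close>

declare dsum.simps [simp del] digits.simps [simp del]

definition has_density :: "(nat \<Rightarrow> bool) \<Rightarrow> real \<Rightarrow> bool" where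
  "has_density P x \<longleftrightarrow> (\<lambda>N. real (card {n. n < N \<and> P n}) / real N) \<longlonglongrightarrow> x"

lemma has_density_False: "has_density (\<lambda>n. False) 0"
  by (simp add: has_density_def)

lemma has_density_True: "has_density (\<lambda>n. True) 1"
  unfolding has_density_def
  by (rule tendsto_eventually) (use eventually_gt_at_top[of 0] in \<open>eventually_elim, simp\<close>)

lemma has_density_unique: "has_density P x \<Longrightarrow> has_density P y \<Longrightarrow> x = y"
  unfolding has_density_def by (rule LIMSEQ_unique)

text \<open>A residue class modulo b fills a proportion 1/b of each long initial segment; the shift
  \<open>j\<close> covers all classes at once. Squeeze, as the floor differs from the quotient by at
  most 1.\<close>

lemma tendsto_shifted_div:
  assumes "b > 0"
  shows "(\<lambda>N. real ((N + j) div b) / real N) \<longlonglongrightarrow> 1 / real b"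
proof (rule tendsto_sandwich)
  have *: "real (k div b) \<le> real k / real b" "real k / real b - 1 \<le> real (k div b)" for k
  proof -
    have "real k = real b * real (k div b) + real (k mod b)"
      by (metis of_nat_add of_nat_mult mult_div_mod_eq)
    moreover have "0 \<le> real (k mod b)" "real (k mod b) < real b" 
      using assms by simp_all
    ultimately show "real (k div b) \<le> real k / real b" "real k / real b - 1 \<le> real (k div b)"
      using assms by (simp_all add: field_simps)
  qed
  show "\<forall>\<^sub>F N in sequentially.
      (real (N + j) / real b - 1) / real N \<le> real ((N + j) div b) / real N"
    by (intro always_eventually allI divide_right_mono *) auto
  show "\<forall>\<^sub>F N in sequentially.
      real ((N + j) div b) / real N \<le> (real (N + j) / real b) / real N"
    by (intro always_eventually allI divide_right_mono *) auto
  have inv: "(\<lambda>N. c / real N) \<longlonglongrightarrow> 0" for c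
    by (rule lim_const_over_n)
  have "(\<lambda>N. (1 + real j / real N) / real b) \<longlonglongrightarrow> (1 + 0) / real b"
    using assms by (intro tendsto_intros inv) auto
  moreover have ev: "\<forall>\<^sub>F N in sequentially. (1 + real j / real N) / real b = (real (N + j) / real b) / real N"
    using eventually_gt_at_top[of 0] by eventually_elim (use assms in \<open>simp add: field_simps\<close>)
  ultimately show upper: "(\<lambda>N. (real (N + j) / real b) / real N) \<longlonglongrightarrow> 1 / real b"
    by (simp add: filterlim_cong[OF refl refl ev])
  show "(\<lambda>N. (real (N + j) / real b - 1) / real N) \<longlonglongrightarrow> 1 / real b"
    using tendsto_diff[OF upper inv[of 1]] by (simp add: diff_divide_distrib)
qed

text \<open>There are finitely many classes, so the limit may be taken class by class. Each class
  contributes its own density times its proportion 1/b.\<close>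

lemma has_density_residues:
  assumes "b > 0" and dens: "\<And>a. a < b \<Longrightarrow> has_density (\<lambda>m. P (b * m + a)) (x a)"
  shows "has_density P ((\<Sum>a<b. x a) / real b)"
proof -
  \<comment> \<open>\<open>M a N\<close> is the number of m with b m + a < N, that is (N - a) / b
    rounded up, written without truncated subtraction from \<open>N\<close>.\<close>
  define M where "M a N = (N + (b - 1 - a)) div b" for a N
  define B where "B a K = {m. m < K \<and> P (b * m + a)}" for a K
  have less_M: "m < M a N \<longleftrightarrow> b * m + a < N" if "a < b" for a m N
  proof -
    have "m < M a N \<longleftrightarrow> Suc m * b \<le> N + (b - 1 - a)"
      unfolding M_def using \<open>b > 0\<close>
      by (metis Suc_le_eq less_eq_div_iff_mult_less_eq)
    also have "\<dots> \<longleftrightarrow> b * m + a < N"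
      using that by (auto simp: algebra_simps)
    finally show ?thesis .
  qed
  have card_eq: "card {n. n < N \<and> P n} = (\<Sum>a<b. card (B a (M a N)))" for N
  proof -
    have "{n. n < N \<and> P n} = (\<Union>a<b. (\<lambda>m. b * m + a) ` B a (M a N))"
    proof (intro set_eqI iffI)
      fix n assume n: "n \<in> {n. n < N \<and> P n}"
      have "n mod b < b" "n = b * (n div b) + n mod b"
        using \<open>b > 0\<close> by auto
      then show "n \<in> (\<Union>a<b. (\<lambda>m. b * m + a) ` B a (M a N))"
        using n less_M[of "n mod b" "n div b" N]
        by (intro UN_I[of "n mod b"] image_eqI[of _ _ "n div b"]) (auto simp: B_def)
    next
      fix n assume "n \<in> (\<Union>a<b. (\<lambda>m. b * m + a) ` B a (M a N))"
      then show "n \<in> {n. n < N \<and> P n}"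
        using less_M by (auto simp: B_def)
    qed
    also have "card \<dots> = (\<Sum>a<b. card ((\<lambda>m. b * m + a) ` B a (M a N)))"
    proof (rule card_UN_disjoint)
      show "\<forall>i\<in>{..<b}. \<forall>j\<in>{..<b}. i \<noteq> j \<longrightarrow>
        (\<lambda>m. b * m + i) ` B i (M i N) \<inter> (\<lambda>m. b * m + j) ` B j (M j N) = {}"
      proof (intro ballI impI)
        fix i j assume "i \<in> {..<b}" "j \<in> {..<b}" "i \<noteq> j"
        then have "b * m + i \<noteq> b * m' + j" for m m'
          by (metis lessThan_iff mod_less mod_mult_self4)
        then show "(\<lambda>m. b * m + i) ` B i (M i N) \<inter> (\<lambda>m. b * m + j) ` B j (M j N) = {}"
          by auto
      qed
    qed (auto simp: B_def)
    also have "\<dots> = (\<Sum>a<b. card (B a (M a N)))"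
      using \<open>b > 0\<close> by (intro sum.cong refl card_image) (auto simp: inj_on_def)
    finally show ?thesis .
  qed
  have "(\<lambda>N. real (card (B a (M a N))) / real N) \<longlonglongrightarrow> x a * (1 / real b)" if "a < b" for a
  proof -
    have "filterlim (M a) at_top sequentially"
      unfolding filterlim_at_top
    proof
      fix Z
      have "Z \<le> M a N" if "N \<ge> Z * b" for N
        using that \<open>b > 0\<close> by (simp add: M_def less_eq_div_iff_mult_less_eq)
      then show "\<forall>\<^sub>F N in sequentially. Z \<le> M a N"
        by (auto simp: eventually_sequentially)
    qed
    then have "(\<lambda>N. real (card (B a (M a N))) / real (M a N)) \<longlonglongrightarrow> x a"
      using dens[OF that] unfolding has_density_def B_def
      by (rule filterlim_compose[rotated])
    moreover have "(\<lambda>N. real (M a N) / real N) \<longlonglongrightarrow> 1 / real b"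
      unfolding M_def by (rule tendsto_shifted_div[OF \<open>b > 0\<close>])
    ultimately have "(\<lambda>N. real (card (B a (M a N))) / real (M a N) * (real (M a N) / real N))
        \<longlonglongrightarrow> x a * (1 / real b)"
      by (rule tendsto_mult)
    \<comment> \<open>If \<open>M a N = 0\<close>, division by zero gives 0 on the left, and the
      right side is 0 because the set is then empty.\<close>
    moreover have "real (card (B a (M a N))) / real (M a N) * (real (M a N) / real N)
        = real (card (B a (M a N))) / real N" for N
      by (cases "M a N = 0") (auto simp: B_def)
    ultimately show ?thesis by (simp only:)
  qed
  then have "(\<lambda>N. \<Sum>a<b. real (card (B a (M a N))) / real N) \<longlonglongrightarrow> (\<Sum>a<b. x a * (1 / real b))"
    by (intro tendsto_sum) auto
  then show ?thesis
    by (simp add: has_density_def card_eq sum_divide_distrib)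
qed

section \<open>Recursions for \<open>Delta\<close> and its densities under appending a digit\<close>

locale digit_base =
  fixes b :: nat
  assumes base_ge_2: "b \<ge> 2"
begin

lemma base_pos: "b > 0" "real b > 0"
  using base_ge_2 by auto

text \<open>The value 1 is a separate base case because there q = 0 and c = 1, so
  \<open>Suc q\<close> is the number itself. The guard \<open>c > 0\<close> is there for the same
  reason: for b = 2 the number 2 has q = 1, c = 0 and again equals \<open>Suc q\<close>.\<close>

lemma base_induct [case_names zero one step]:
  assumes "P 0" "P 1"
    and "\<And>q c. c < b \<Longrightarrow> b * q + c \<ge> 2 \<Longrightarrow> P q \<Longrightarrow> (c > 0 \<Longrightarrow> P (Suc q)) \<Longrightarrow> P (b * q + c)"
  shows "P r"
proof (induction r rule: less_induct)
  case (less r)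
  consider "r = 0" | "r = 1" | "r \<ge> 2" by linarith
  then show ?case
  proof cases
    case 3
    define q c where "q = r div b" and "c = r mod b"
    have r: "r = b * q + c" and c: "c < b"
      using base_pos by (auto simp: q_def c_def)
    have "2 * q \<le> b * q" using base_ge_2 by simp
    have "q < r" using 3 base_ge_2 by (simp add: q_def)
    moreover have "Suc q < r" if "c > 0"
      using \<open>2 * q \<le> b * q\<close> r 3 that by (cases q) auto
    ultimately show ?thesis
      unfolding r using 3 r c by (intro assms(3)) (auto intro: less.IH)
  qed (use assms in auto)
qed

lemma dsum_append: "a < b \<Longrightarrow> dsum b (b * m + a) = a + dsum b m"
proof -
  assume "a < b"
  then have "(b * m + a) mod b = a" "(b * m + a) div b = m"
    by auto
  moreover have "dsum b 0 = 0"
    by (simp add: dsum.simps)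
  ultimately show ?thesis
    using base_ge_2 dsum.simps[of b "b * m + a"] by auto
qed

lemma Delta_append:
  assumes "a < b" "c < b"
  shows "Delta b (b * q + c) (b * m + a) =
    (if a < b - c then Delta b q m + int c else Delta b (Suc q) m + int c - int b)"
proof (cases "a < b - c")
  case True
  then have "dsum b (b * m + a + (b * q + c)) = (a + c) + dsum b (m + q)"
    using dsum_append[of "a + c" "m + q"] by (simp add: algebra_simps)
  then show ?thesis
    using True dsum_append[of a m] assms by (simp add: Delta_def)
next
  case False
  then have "b * m + a + (b * q + c) = b * (m + Suc q) + (a + c - b)"
    by (simp add: algebra_simps)
  then have "dsum b (b * m + a + (b * q + c)) = (a + c - b) + dsum b (m + Suc q)"
    using dsum_append[of "a + c - b" "m + Suc q"] assms by simp
  then show ?thesis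
    using False dsum_append[of a m] assms by (simp add: Delta_def)
qed

text \<open>Of the b possible last digits, b - c produce no carry and c produce one. The guard on
  the last assumption matches the one in \<open>base_induct\<close>.\<close>

lemma has_density_Delta_append:
  assumes "c < b" "has_density (\<lambda>m. Delta b q m = d - int c) x"
    and "c > 0 \<Longrightarrow> has_density (\<lambda>m. Delta b (Suc q) m = d - int c + int b) y"
  shows "has_density (\<lambda>n. Delta b (b * q + c) n = d) ((real (b - c) * x + real c * y) / real b)"
proof -
  have "has_density (\<lambda>n. Delta b (b * q + c) n = d)
      ((\<Sum>a<b. if a < b - c then x else y) / real b)"
  proof (rule has_density_residues[OF base_pos(1)])
    fix a assume "a < b"
    have "(\<lambda>m. Delta b (b * q + c) (b * m + a) = d) =
       (if a < b - c then (\<lambda>m. Delta b q m = d - int c)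
        else (\<lambda>m. Delta b (Suc q) m = d - int c + int b))"
      using \<open>a < b\<close> \<open>c < b\<close> by (auto simp: Delta_append fun_eq_iff)
    then show "has_density (\<lambda>m. Delta b (b * q + c) (b * m + a) = d) (if a < b - c then x else y)"
      using assms \<open>a < b\<close> by auto
  qed
  also have "(\<Sum>a<b. if a < b - c then x else y) = real (b - c) * x + real c * y"
  proof -
    have "{..<b} \<inter> {a. a < b - c} = {..<b - c}" "{..<b} \<inter> - {a. a < b - c} = {b - c..<b}"
      by auto
    then show ?thesis
      using \<open>c < b\<close> by (simp add: sum.If_cases)
  qed
  finally show ?thesis .
qed

text \<open>Adding 1 raises one digit by 1 and turns trailing digits b - 1 into 0. The bound is what
  stops the self-referential recursion for r = 1.\<close>

lemma Delta_1_le: "Delta b 1 n \<le> 1"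
proof (induction n rule: less_induct)
  case (less n)
  define m a where "m = n div b" and "a = n mod b"
  have n: "n = b * m + a" and a: "a < b"
    using base_pos by (auto simp: m_def a_def)
  have *: "Delta b 1 n = (if a < b - 1 then Delta b 0 m + 1 else Delta b 1 m + 1 - int b)"
    using Delta_append[OF a, of 1 0 m] base_ge_2 by (simp add: n)
  show ?case
  proof (cases "a < b - 1")
    case True
    then show ?thesis unfolding * by (simp add: Delta_def)
  next
    case False
    then have "m < n"
      using base_ge_2 a mult_le_mono1[OF base_ge_2, of m] unfolding n by linarith
    then show ?thesis
      using False less[of m] base_ge_2 unfolding * by simp
  qed
qed

lemma has_density_Delta: "\<exists>x. has_density (\<lambda>n. Delta b r n = d) x"
proof (induction r arbitrary: d rule: base_induct)
  case zero
  then show ?case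
    using has_density_True has_density_False by (cases "d = 0") (auto simp: Delta_def)
next
  case one
  \<comment> \<open>For r = 1 the recursion leads back to r = 1, but with the larger value d - 1 +
    b. So the induction runs on the distance of d below 2; from 2 on the density is 0.\<close>
  show ?case
  proof (induction "nat (2 - d)" arbitrary: d rule: less_induct)
    case less
    show ?case
    proof (cases "d \<ge> 2")
      case True
      then have "(\<lambda>n. Delta b 1 n = d) = (\<lambda>n. False)"
        using Delta_1_le by (intro ext) (metis not_less order.strict_trans2 one_less_numeral_iff semiring_norm(76))
      then show ?thesis using has_density_False by metis
    next
      case False
      have "\<exists>y. has_density (\<lambda>n. Delta b 1 n = d - 1 + int b) y"
        using False base_ge_2 by (intro less) auto
      moreover have "\<exists>x. has_density (\<lambda>n. Delta b 0 n = d - 1) x"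
        using has_density_True has_density_False by (cases "d = 1") (auto simp: Delta_def)
      ultimately show ?thesis
        using has_density_Delta_append[of 1 0 d] base_ge_2 by fastforce
    qed
  qed
next
  case (step q c)
  then show ?case
    using has_density_Delta_append[of c q d] by metis
qed

text \<open>\<open>lim\<close> is informative only for convergent sequences; the existence of the
  density makes \<open>mu\<close> the actual limit.\<close>

lemma has_density_mu: "has_density (\<lambda>n. Delta b r n = d) (mu b r d)"
  using has_density_Delta[of r d] unfolding has_density_def mu_def
  by (auto dest: limI)

lemma mu_append:
  assumes "c < b"
  shows "mu b (b * q + c) d =
    (real (b - c) * mu b q (d - int c) + real c * mu b (Suc q) (d - int c + int b)) / real b"
  by (intro has_density_unique[OF has_density_mu] has_density_Delta_append has_density_mu assms)

lemma mu_0: "mu b 0 d = (if d = 0 then 1 else 0)"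
proof -
  have "has_density (\<lambda>n. Delta b 0 n = d) (if d = 0 then 1 else 0)"
    using has_density_True has_density_False by (auto simp: Delta_def)
  with has_density_mu show ?thesis by (rule has_density_unique)
qed

lemma mu_nonneg: "mu b r d \<ge> 0"
  by (rule LIMSEQ_le_const[OF has_density_mu[unfolded has_density_def]]) (auto intro!: exI[of _ 0])

lemma mu_1_eq_0: "d > 1 \<Longrightarrow> mu b 1 d = 0"
proof -
  assume "d > 1"
  then have "(\<lambda>n. Delta b 1 n = d) = (\<lambda>n. False)"
    using Delta_1_le by (intro ext) (metis not_less)
  then show ?thesis
    using has_density_mu[of 1 d] has_density_False has_density_unique by metis
qed

end

subsection \<open>Expectation with respect to the limit measures\<close>

text \<open>The comparison series has terms y^n (n + 1) (n + 2), the second derivative of the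
  geometric series, obtained by applying \<open>diffs\<close> twice.\<close>

lemma summable_quadratic_geometric:
  fixes y :: real
  assumes "0 \<le> y" "y < 1"
  shows "summable (\<lambda>k. y ^ k * (1 + (1 - real k)\<^sup>2))"
proof (rule summable_comparison_test')
  have 1: "summable (\<lambda>n. diffs (\<lambda>_. 1 :: real) n * x ^ n)" if "norm x < 1" for x :: real
    using that by (rule termdiff_converges) (simp add: summable_geometric)
  show "summable (\<lambda>n. diffs (diffs (\<lambda>_. 1 :: real)) n * y ^ n)"
    by (rule termdiff_converges[where K = 1, OF _ 1]) (use assms in auto)
  fix n :: nat
  have "1 + (1 - real n)\<^sup>2 \<le> real (Suc n) * real (Suc (Suc n))"
    by (simp add: power2_eq_square algebra_simps)
  then have "y ^ n * (1 + (1 - real n)\<^sup>2) \<le> y ^ n * (real (Suc n) * real (Suc (Suc n)))"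
    using assms by (intro mult_left_mono) auto
  then show "norm (y ^ n * (1 + (1 - real n)\<^sup>2)) \<le> diffs (diffs (\<lambda>_. 1 :: real)) n * y ^ n"
    using assms by (simp add: diffs_def mult_ac)
qed

text \<open>One class of test functions for all later expectations: constants, the identity, the
  square and \<open>cis\<close>. It is stable under translation, as the digit recursion
  requires.\<close>

definition quad_bounded :: "(int \<Rightarrow> 'a::real_normed_vector) \<Rightarrow> bool" where
  "quad_bounded f \<longleftrightarrow> (\<exists>C. \<forall>d. norm (f d) \<le> C * (1 + (real_of_int d)\<^sup>2))"

lemma quad_boundedI: "(\<And>d. norm (f d) \<le> C * (1 + (real_of_int d)\<^sup>2)) \<Longrightarrow> quad_bounded f"
  unfolding quad_bounded_def by blast

text \<open>The right side minus the left side is (d - k)^2 + 1 + 2 k^2 d^2.\<close>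

lemma quad_weight_shift: 
  "1 + (real_of_int (d + k))\<^sup>2 \<le> 2 * (1 + (real_of_int k)\<^sup>2) * (1 + (real_of_int d)\<^sup>2)"
proof -
  have "0 \<le> (real_of_int d - real_of_int k)\<^sup>2 + 1 + 2 * (real_of_int k)\<^sup>2 * (real_of_int d)\<^sup>2"
    by simp
  then show ?thesis by (simp add: power2_eq_square algebra_simps)
qed

lemma quad_bounded_shift:
  assumes "quad_bounded f"
  shows "quad_bounded (\<lambda>d. f (d + k))"
proof -
  obtain C where C: "norm (f d) \<le> C * (1 + (real_of_int d)\<^sup>2)" for d
    using assms unfolding quad_bounded_def by blast
  have "0 \<le> C" using order_trans[OF norm_ge_zero C[of 0]] by simp
  then have "norm (f (d + k)) \<le> C * (2 * (1 + (real_of_int k)\<^sup>2) * (1 + (real_of_int d)\<^sup>2))" for d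
    by (meson C quad_weight_shift mult_left_mono order_trans)
  then show ?thesis
    by (intro quad_boundedI[of _ "C * (2 * (1 + (real_of_int k)\<^sup>2))"]) (simp add: mult.assoc)
qed

lemma quad_bounded_bounded: "(\<And>d. norm (f d) \<le> C) \<Longrightarrow> quad_bounded f"
proof (rule quad_boundedI)
  fix d assume C: "\<And>d. norm (f d) \<le> C"
  have "0 \<le> C" using order_trans[OF norm_ge_zero C[of 0]] .
  then have "C * 1 \<le> C * (1 + (real_of_int d)\<^sup>2)" by (intro mult_left_mono) auto
  with C[of d] show "norm (f d) \<le> C * (1 + (real_of_int d)\<^sup>2)" by simp
qed

lemma quad_bounded_const: "quad_bounded (\<lambda>d. x)"
  by (rule quad_bounded_bounded) auto

lemma quad_bounded_power2: "quad_bounded (\<lambda>d. (real_of_int d)\<^sup>2)"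
  by (rule quad_boundedI[of _ 1]) auto

lemma quad_bounded_linear: "quad_bounded (\<lambda>d. k * real_of_int d)"
proof (rule quad_boundedI)
  fix d
  have "\<bar>real_of_int d\<bar> \<le> 1 + (real_of_int d)\<^sup>2"
    using zero_le_power2[of "\<bar>real_of_int d\<bar> - 1"] by (simp add: power2_eq_square algebra_simps)
  then show "norm (k * real_of_int d) \<le> \<bar>k\<bar> * (1 + (real_of_int d)\<^sup>2)"
    by (simp add: abs_mult mult_left_mono)
qed

lemma quad_bounded_add:
  assumes "quad_bounded f" "quad_bounded g"
  shows "quad_bounded (\<lambda>d. f d + g d)"
proof -
  obtain C D where "norm (f d) \<le> C * (1 + (real_of_int d)\<^sup>2)"
      "norm (g d) \<le> D * (1 + (real_of_int d)\<^sup>2)" for d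
    using assms unfolding quad_bounded_def by blast
  then have "norm (f d + g d) \<le> (C + D) * (1 + (real_of_int d)\<^sup>2)" for d
    by (metis norm_triangle_mono distrib_right)
  then show ?thesis by (rule quad_boundedI)
qed

lemma quad_bounded_id: "quad_bounded real_of_int"
  using quad_bounded_linear[of 1] by simp

lemma quad_bounded_cis: "quad_bounded (\<lambda>d. cis (t * real_of_int d))"
  by (rule quad_bounded_bounded[of _ 1]) simp

section \<open>Geometric tail, summability and moments of the limit measures\<close>

context digit_base
begin

text \<open>Below 1 the recursion reads mu(d) = mu(d - 1 + b) / b: a move by b - 1 costs a factor
  1/b. Bernoulli's inequality gives 1/b \<le> (1 - 1/b)^(b - 1), that is, a factor 1 - 1/b per
  unit.\<close>

lemma mu_1_le: "mu b 1 d \<le> (1 - 1 / real b) ^ nat (1 - d)"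
proof (induction "nat (2 - d)" arbitrary: d rule: less_induct)
  case less
  have b: "1 < b" using base_ge_2 by simp
  have y: "0 \<le> 1 - 1 / real b" using b by simp
  have rec: "mu b 1 d = (real (b - 1) * mu b 0 (d - 1) + mu b 1 (d - 1 + int b)) / real b"
    using mu_append[of 1 0 d] b by simp
  consider "d > 1" | "d = 1" | "d < 1" by linarith
  then show ?case
  proof cases
    case 1
    then show ?thesis using mu_1_eq_0[of d] y by simp
  next
    case 2
    then show ?thesis
      unfolding rec using b mu_1_eq_0[of "int b"] by (simp add: mu_0)
  next
    case 3
    then have *: "mu b 1 d = mu b 1 (d - 1 + int b) / real b"
      unfolding rec by (simp add: mu_0)
    show ?thesis
    proof (cases "d - 1 + int b > 1")
      case True
      then show ?thesis unfolding * using y mu_1_eq_0[of "d - 1 + int b"] by simp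
    next
      case False
      have "1 + real (b - 1) * (- (1 / real b)) \<le> (1 + (- (1 / real b))) ^ (b - 1)"
        using b by (intro Bernoulli_inequality) auto
      moreover have "1 + real (b - 1) * (- (1 / real b)) = 1 / real b"
        using b by (simp add: field_simps of_nat_diff)
      ultimately have bern: "1 / real b \<le> (1 - 1 / real b) ^ (b - 1)"
        by simp
      have "mu b 1 (d - 1 + int b) \<le> (1 - 1 / real b) ^ nat (1 - (d - 1 + int b))"
        using b 3 by (intro less) auto
      then have "mu b 1 (d - 1 + int b) * (1 / real b)
          \<le> (1 - 1 / real b) ^ nat (1 - (d - 1 + int b)) * (1 - 1 / real b) ^ (b - 1)"
        using bern y by (intro mult_mono) auto
      also have "\<dots> = (1 - 1 / real b) ^ (nat (1 - (d - 1 + int b)) + (b - 1))"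
        by (simp add: power_add)
      also have "nat (1 - (d - 1 + int b)) + (b - 1) = nat (1 - d)"
        using False b by linarith
      finally show ?thesis unfolding * by simp
    qed
  qed
qed

lemma summable_mu_weight_shift:
  "(\<lambda>d. mu b r (d - k) * (1 + (real_of_int d)\<^sup>2)) summable_on UNIV"
  if "(\<lambda>d. mu b r d * (1 + (real_of_int d)\<^sup>2)) summable_on UNIV"
proof -
  have "(\<lambda>d. mu b r d * (1 + (real_of_int (d + k))\<^sup>2)) summable_on UNIV"
  proof (rule summable_on_comparison_test)
    show "(\<lambda>d. 2 * (1 + (real_of_int k)\<^sup>2) * (mu b r d * (1 + (real_of_int d)\<^sup>2))) summable_on UNIV"
      using that by (rule summable_on_cmult_right)
    show "mu b r d * (1 + (real_of_int (d + k))\<^sup>2)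
        \<le> 2 * (1 + (real_of_int k)\<^sup>2) * (mu b r d * (1 + (real_of_int d)\<^sup>2))" for d
      using mult_left_mono[OF quad_weight_shift mu_nonneg] by (simp only: mult_ac)
  qed (simp add: mu_nonneg)
  also have "?this \<longleftrightarrow> ?thesis"
    by (rule summable_on_reindex_bij_witness[where i = "\<lambda>d. d - k" and j = "\<lambda>d. d + k"]) auto
  finally show ?thesis .
qed

text \<open>With weight 1 + d^2, one induction secures total mass, mean and second moment together.
  The case r = 1 is compared with the geometric series through k = 1 - d.\<close>

lemma summable_mu_weight: "(\<lambda>d. mu b r d * (1 + (real_of_int d)\<^sup>2)) summable_on UNIV"
proof (induction r rule: base_induct)
  case zero
  have "(\<lambda>d. mu b 0 d * (1 + (real_of_int d)\<^sup>2)) summable_on {0}"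
    by simp
  also have "?this \<longleftrightarrow> ?case"
    by (rule summable_on_cong_neutral) (auto simp: mu_0)
  finally show ?case .
next
  case one
  define y where "y = 1 - 1 / real b"
  have y: "0 \<le> y" "y < 1" using base_ge_2 by (auto simp: y_def)
  have "(\<lambda>k. y ^ k * (1 + (1 - real k)\<^sup>2)) summable_on UNIV"
    using summable_quadratic_geometric[OF y] y by (intro norm_summable_imp_summable_on) simp
  also have "?this \<longleftrightarrow> (\<lambda>d. y ^ nat (1 - d) * (1 + (real_of_int d)\<^sup>2)) summable_on {..1}"
    by (rule summable_on_reindex_bij_witness[where i = "\<lambda>d. nat (1 - d)" and j = "\<lambda>k. 1 - int k"])
       auto
  finally have "(\<lambda>d. mu b 1 d * (1 + (real_of_int d)\<^sup>2)) summable_on {..1}"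
    by (rule summable_on_comparison_test)
       (use mu_1_le mu_nonneg in \<open>auto simp: y_def intro: mult_right_mono\<close>)
  also have "?this \<longleftrightarrow> ?case"
    by (rule summable_on_cong_neutral) (auto simp: mu_1_eq_0[simplified])
  finally show ?case .
next
  case (step q c)
  have q: "(\<lambda>d. mu b q (d - int c) * (1 + (real_of_int d)\<^sup>2)) summable_on UNIV"
    using step by (intro summable_mu_weight_shift)
  have "(\<lambda>d. real c * (mu b (Suc q) (d - (int c - int b)) * (1 + (real_of_int d)\<^sup>2))) summable_on UNIV"
    using step by (cases "c = 0") (auto intro!: summable_on_cmult_right summable_mu_weight_shift)
  with q have "(\<lambda>d. real (b - c) / real b * (mu b q (d - int c) * (1 + (real_of_int d)\<^sup>2)) +
      1 / real b * (real c * (mu b (Suc q) (d - (int c - int b)) * (1 + (real_of_int d)\<^sup>2)))) summable_on UNIV"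
    by (intro summable_on_add; elim summable_on_cmult_right)
  then show ?case
    by (rule summable_on_cong[THEN iffD1, rotated])
       (simp only: mu_append[OF step(1)], simp add: algebra_simps add_divide_distrib)
qed

lemma abs_summable_mu:
  assumes "quad_bounded f"
  shows "(\<lambda>d. norm (mu b r d *\<^sub>R f d)) summable_on UNIV"
proof -
  obtain C where C: "norm (f d) \<le> C * (1 + (real_of_int d)\<^sup>2)" for d
    using assms unfolding quad_bounded_def by blast
  show ?thesis
  proof (rule Infinite_Sum.abs_summable_on_comparison_test')
    show "(\<lambda>d. C * (mu b r d * (1 + (real_of_int d)\<^sup>2))) summable_on UNIV"
      by (intro summable_on_cmult_right summable_mu_weight)
    show "norm (mu b r d *\<^sub>R f d) \<le> C * (mu b r d * (1 + (real_of_int d)\<^sup>2))" for d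
      using mult_left_mono[OF C mu_nonneg] by (simp add: mu_nonneg mult_ac)
  qed
qed

lemma summable_mu:
  fixes f :: "int \<Rightarrow> 'a::banach"
  shows "quad_bounded f \<Longrightarrow> (\<lambda>d. mu b r d *\<^sub>R f d) summable_on UNIV"
  by (rule abs_summable_summable[OF abs_summable_mu])

text \<open>Written with \<open>scaleR\<close> so that real moments and complex characteristic
  functions share one recursion.\<close>

definition mean :: "nat \<Rightarrow> (int \<Rightarrow> 'a::banach) \<Rightarrow> 'a" where
  "mean r f = (\<Sum>\<^sub>\<infinity>d. mu b r d *\<^sub>R f d)"

lemma mean_add:
  "quad_bounded f \<Longrightarrow> quad_bounded g \<Longrightarrow> mean r (\<lambda>d. f d + g d) = mean r f + mean r g"
  unfolding mean_def by (simp add: scaleR_add_right infsum_add summable_mu)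

text \<open>Holds without a growth condition: a nonzero factor preserves summability, and
  \<open>infsum\<close> of a non-summable family is 0.\<close>

lemma mean_mult: "mean r (\<lambda>d. k * f d) = k * mean r f" for k :: "'a::{real_normed_field,banach}"
  unfolding mean_def by (simp add: infsum_cmult_right' flip: mult_scaleR_right)

lemma mean_0: "mean 0 f = f 0"
proof -
  have "mean 0 f = (\<Sum>\<^sub>\<infinity>d\<in>{0}. mu b 0 d *\<^sub>R f d)"
    unfolding mean_def by (rule infsum_cong_neutral) (auto simp: mu_0)
  then show ?thesis by (simp add: mu_0)
qed

lemma mean_shift: "(\<Sum>\<^sub>\<infinity>d. mu b r (d - k) *\<^sub>R f d) = mean r (\<lambda>d. f (d + k))"
  unfolding mean_def
  by (rule infsum_reindex_bij_witness[where i = "\<lambda>d. d + k" and j = "\<lambda>d. d - k"]) auto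

lemma summable_mu_shifted:
  fixes f :: "int \<Rightarrow> 'a::banach"
  assumes "quad_bounded f"
  shows "(\<lambda>d. mu b r (d - k) *\<^sub>R f d) summable_on UNIV"
proof -
  have "(\<lambda>d. mu b r d *\<^sub>R f (d + k)) summable_on UNIV"
    by (intro summable_mu quad_bounded_shift assms)
  also have "?this \<longleftrightarrow> ?thesis"
    by (rule summable_on_reindex_bij_witness[where i = "\<lambda>d. d - k" and j = "\<lambda>d. d + k"]) auto
  finally show ?thesis .
qed

lemma mean_append:
  assumes "c < b" "quad_bounded f"
  shows "mean (b * q + c) f = (real (b - c) / real b) *\<^sub>R mean q (\<lambda>d. f (d + int c))
    + (real c / real b) *\<^sub>R mean (Suc q) (\<lambda>d. f (d + (int c - int b)))"
proof -
  have "mean (b * q + c) f = (\<Sum>\<^sub>\<infinity>d. (real (b - c) / real b) *\<^sub>R (mu b q (d - int c) *\<^sub>R f d)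
      + (real c / real b) *\<^sub>R (mu b (Suc q) (d - (int c - int b)) *\<^sub>R f d))"
    unfolding mean_def
    by (intro infsum_cong) (simp add: mu_append[OF assms(1)] add_divide_distrib scaleR_add_left diff_diff_eq2 diff_add_eq)
  also have "\<dots> = (real (b - c) / real b) *\<^sub>R (\<Sum>\<^sub>\<infinity>d. mu b q (d - int c) *\<^sub>R f d)
      + (real c / real b) *\<^sub>R (\<Sum>\<^sub>\<infinity>d. mu b (Suc q) (d - (int c - int b)) *\<^sub>R f d)"
    by (simp only: infsum_add summable_on_scaleR_right summable_mu_shifted assms infsum_scaleR_right)
  finally show ?thesis by (simp add: mean_shift)
qed

lemma mean_1:
  assumes "quad_bounded f"
  shows "mean 1 f = ((real b - 1) / real b) *\<^sub>R f 1 + (1 / real b) *\<^sub>R mean 1 (\<lambda>d. f (d + (1 - int b)))"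
  using mean_append[of 1 f 0] assms base_ge_2 by (simp add: mean_0 of_nat_diff)

text \<open>Natural density is not countably additive, so it must be shown that no mass is lost. For
  r = 1 the mass x solves x = (b - 1)/b + x/b, which forces x = 1; the recursion then preserves
  mass.\<close>

lemma mean_const_1: "mean r (\<lambda>d. 1 :: real) = 1"
proof (induction r rule: base_induct)
  case one
  show ?case
  proof -
    have "mean 1 (\<lambda>d. 1 :: real) = (real b - 1) / real b + mean 1 (\<lambda>d. 1 :: real) / real b"
      using mean_1[OF quad_bounded_const[of "1 :: real"]] by simp
    moreover have "(real b - 1) * (x - 1) = real b * (x - ((real b - 1) / real b + x / real b))" for x
      using base_pos(2) by (simp add: field_simps)
    ultimately have "(real b - 1) * (mean 1 (\<lambda>d. 1 :: real) - 1) = 0"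
      by simp
    then show ?thesis using base_ge_2 by simp
  qed
next
  case (step q c)
  have "real c * mean (Suc q) (\<lambda>d. 1 :: real) = real c"
    using step by (cases "c = 0") auto
  moreover have "mean (b * q + c) (\<lambda>d. 1 :: real) =
      (real (b - c) + real c * mean (Suc q) (\<lambda>d. 1 :: real)) / real b"
    using mean_append[OF step(1) quad_bounded_const[of "1 :: real"], of q] step
    by (simp add: add_divide_distrib)
  ultimately show ?case
    using step(1) base_pos by (simp add: of_nat_diff)
qed (simp add: mean_0)

lemma mean_const: "mean r (\<lambda>d. x) = (x :: real)"
  using mean_mult[of r x "\<lambda>d. 1"] mean_const_1 by simp

lemma mean_linear: "mean r (\<lambda>d. real_of_int (d + k)) = mean r real_of_int + real_of_int k"
  using mean_add[OF quad_bounded_id quad_bounded_const[of "real_of_int k"], of r]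
  by (simp add: mean_const)

text \<open>The shifts c and c - b, taken with weights (b - c)/b and c/b, cancel.\<close>

lemma mean_id: "mean r real_of_int = 0"
proof (induction r rule: base_induct)
  case one
  show ?case
    using mean_1[OF quad_bounded_id] base_ge_2 unfolding mean_linear by (simp add: field_simps)
next
  case (step q c)
  have "real c * mean (Suc q) real_of_int = 0"
    using step by (cases "c = 0") auto
  then show ?case
    using mean_append[OF step(1) quad_bounded_id, of q] step base_pos
    unfolding mean_linear by (auto simp: field_simps of_nat_diff)
qed (simp add: mean_0)

section \<open>Variance and characteristic function: their digit recursions\<close>

definition V :: "nat \<Rightarrow> real" where
  "V r = mean r (\<lambda>d. (real_of_int d)\<^sup>2)"

lemma Var_mu_eq: "Var_mu b r = V r"
  using mean_id[of r] by (simp add: Var_mu_def V_def mean_def mult.commute)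

lemma mean_square: "mean r (\<lambda>d. (real_of_int (d + k))\<^sup>2) = V r + (real_of_int k)\<^sup>2"
proof -
  have "mean r (\<lambda>d. (real_of_int d)\<^sup>2 + ((real_of_int k)\<^sup>2 + 2 * real_of_int k * real_of_int d))
      = V r + (mean r (\<lambda>d. (real_of_int k)\<^sup>2) + mean r (\<lambda>d. 2 * real_of_int k * real_of_int d))"
    unfolding V_def
    by (simp add: mean_add quad_bounded_add quad_bounded_power2 quad_bounded_const quad_bounded_linear)
  then show ?thesis
    unfolding mean_const mean_mult mean_id by (simp add: power2_eq_square algebra_simps)
qed

lemma V_0: "V 0 = 0"
  by (simp add: V_def mean_0)

text \<open>The term c (b - c) is the variance of the shift that equals c with probability (b - c)/b
  and c - b with probability c/b.\<close>

lemma V_append: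
  assumes "c < b"
  shows "V (b * q + c) = ((real b - real c) * V q + real c * V (Suc q)) / real b + real c * (real b - real c)"
proof -
  have "V (b * q + c) = (real b - real c) / real b * (V q + (real c)\<^sup>2)
      + real c / real b * (V (Suc q) + (real c - real b)\<^sup>2)"
    unfolding V_def[of "b * q + c"]
    using mean_append[OF assms quad_bounded_power2, of q] assms
    unfolding mean_square by (simp add: of_nat_diff)
  also have "\<dots> = ((real b - real c) * V q + real c * V (Suc q)) / real b + real c * (real b - real c)"
    using base_pos(2) by (simp add: field_simps power2_eq_square)
  finally show ?thesis .
qed

definition phi :: "nat \<Rightarrow> real \<Rightarrow> complex" where
  "phi r t = mean r (\<lambda>d. cis (t * real_of_int d))"

lemma phi_0: "phi 0 t = 1"
  by (simp add: phi_def mean_0)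

lemma mean_cis: "mean r (\<lambda>d. cis (t * real_of_int (d + k))) = cis (t * real_of_int k) * phi r t"
  using mean_mult[of r "cis (t * real_of_int k)" "\<lambda>d. cis (t * real_of_int d)"]
  by (simp add: phi_def cis_mult algebra_simps)

lemma phi_append:
  assumes "c < b"
  shows "phi (b * q + c) t = of_real ((real b - real c) / real b) * cis (t * real c) * phi q t
    + of_real (real c / real b) * cis (t * (real c - real b)) * phi (Suc q) t"
  using mean_append[OF assms quad_bounded_cis[of t], of q] assms
  unfolding mean_cis by (simp add: phi_def scaleR_conv_of_real of_nat_diff mult.assoc)

end

subsection \<open>Gaussian approximation of the characteristic functions\<close>

text \<open>In the application \<open>x\<close> is the shift caused by the digit and
  \<open>s\<close> a difference of variances. The third-order Taylor remainder gives the first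
  summand of the constant, the discarded part of the square the second.\<close>

lemma exp_second_order_bound:
  fixes t x s B :: real
  assumes t: "\<bar>t\<bar> \<le> 1" and x: "\<bar>x\<bar> \<le> B" and s: "\<bar>s\<bar> \<le> B"
  shows "norm (exp (\<i> * (t * x) + t\<^sup>2 * s / 2) - (1 + \<i> * (t * x) + t\<^sup>2 * (s - x\<^sup>2) / 2))
    \<le> (exp (2 * B) * 4 * B ^ 3 + B\<^sup>2) * \<bar>t\<bar> ^ 3"
proof -
  define z :: complex where "z = \<i> * (t * x) + t\<^sup>2 * s / 2"
  \<comment> \<open>\<open>w\<close> is the part of z^2 / 2 of order t^3 and higher.\<close>
  define w :: complex where "w = \<i> * (t ^ 3 * x * s / 2) + t ^ 4 * s\<^sup>2 / 8"
  have B: "0 \<le> B" using x by linarith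
  have t2: "t\<^sup>2 \<le> \<bar>t\<bar>"
    using t by (metis abs_ge_zero mult_left_le power2_abs power2_eq_square)
  have t4: "t ^ 4 \<le> \<bar>t\<bar> ^ 3"
    using t power_decreasing[of 3 4 "\<bar>t\<bar>"] by simp
  have "norm z \<le> norm (\<i> * complex_of_real (t * x)) + norm (complex_of_real (t\<^sup>2 * s / 2))"
    unfolding z_def by (rule order_trans[OF norm_triangle_ineq]) simp
  also have "\<dots> = \<bar>t\<bar> * \<bar>x\<bar> + t\<^sup>2 * \<bar>s\<bar> / 2"
    by (simp add: norm_mult abs_mult norm_divide norm_power)
  also have "\<dots> \<le> \<bar>t\<bar> * B + \<bar>t\<bar> * B"
  proof (rule add_mono)
    show "\<bar>t\<bar> * \<bar>x\<bar> \<le> \<bar>t\<bar> * B" using x by (intro mult_left_mono) auto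
    have "t\<^sup>2 * \<bar>s\<bar> \<le> \<bar>t\<bar> * B" using t2 s by (intro mult_mono) auto
    moreover have "0 \<le> t\<^sup>2 * \<bar>s\<bar>" by simp
    ultimately show "t\<^sup>2 * \<bar>s\<bar> / 2 \<le> \<bar>t\<bar> * B" by linarith
  qed
  finally have z: "norm z \<le> 2 * B * \<bar>t\<bar>" by simp
  also have "\<dots> \<le> 2 * B * 1" using B t by (intro mult_left_mono) auto
  finally have z': "norm z \<le> 2 * B" by simp
  have "norm (exp z - (\<Sum>k\<le>2. z ^ k / fact k)) \<le> exp \<bar>Re z\<bar> * (norm z) ^ Suc 2 / fact 2"
    by (rule Taylor_exp)
  also have "\<dots> \<le> exp (2 * B) * (2 * B * \<bar>t\<bar>) ^ 3 / 2"
  proof -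
    have "\<bar>Re z\<bar> \<le> 2 * B" using abs_Re_le_cmod[of z] z' by linarith
    moreover have "norm z ^ 3 \<le> (2 * B * \<bar>t\<bar>) ^ 3" using z by (intro power_mono) auto
    ultimately have "exp \<bar>Re z\<bar> * norm z ^ 3 \<le> exp (2 * B) * (2 * B * \<bar>t\<bar>) ^ 3"
      by (intro mult_mono) auto
    then show ?thesis by (simp add: eval_nat_numeral mult_ac)
  qed
  finally have 1: "norm (exp z - (\<Sum>k\<le>2. z ^ k / fact k)) \<le> exp (2 * B) * 4 * B ^ 3 * \<bar>t\<bar> ^ 3"
    by (simp add: power_mult_distrib mult_ac)
  have "norm w \<le> norm (\<i> * complex_of_real (t ^ 3 * x * s / 2)) + norm (complex_of_real (t ^ 4 * s\<^sup>2 / 8))"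
    unfolding w_def by (rule order_trans[OF norm_triangle_ineq]) simp
  also have "\<dots> = \<bar>t\<bar> ^ 3 * (\<bar>x\<bar> * \<bar>s\<bar>) / 2 + t ^ 4 * s\<^sup>2 / 8"
    by (simp add: norm_mult abs_mult norm_divide norm_power power_abs)
  also have "\<dots> \<le> \<bar>t\<bar> ^ 3 * (B * B) / 2 + \<bar>t\<bar> ^ 3 * B\<^sup>2 / 8"
  proof (intro add_mono divide_right_mono mult_mono t4 x s)
    show "s\<^sup>2 \<le> B\<^sup>2" using s by (metis abs_ge_zero power2_abs power_mono)
  qed (use B in auto)
  also have "\<dots> \<le> B\<^sup>2 * \<bar>t\<bar> ^ 3"
  proof -
    have "0 \<le> B\<^sup>2 * \<bar>t\<bar> ^ 3" by simp
    then show ?thesis by (simp add: power2_eq_square mult_ac)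
  qed
  finally have 2: "norm w \<le> B\<^sup>2 * \<bar>t\<bar> ^ 3" .
  have "(\<Sum>k\<le>2. z ^ k / fact k) = 1 + z + z\<^sup>2 / 2"
    by (simp add: numeral_2_eq_2)
  also have "\<dots> = (1 + \<i> * (t * x) + t\<^sup>2 * (s - x\<^sup>2) / 2) + w"
    by (simp add: z_def w_def power2_eq_square power3_eq_cube power4_eq_xxxx field_simps)
  finally have "exp z - (1 + \<i> * (t * x) + t\<^sup>2 * (s - x\<^sup>2) / 2)
      = (exp z - (\<Sum>k\<le>2. z ^ k / fact k)) + w"
    by simp
  also have "norm \<dots> \<le> exp (2 * B) * 4 * B ^ 3 * \<bar>t\<bar> ^ 3 + B\<^sup>2 * \<bar>t\<bar> ^ 3"
    using 1 2 by (rule norm_triangle_mono)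
  finally show ?thesis
    by (simp add: z_def distrib_right)
qed

context digit_base
begin

lemma V_nonneg: "0 \<le> V r"
  unfolding V_def mean_def by (intro infsum_nonneg) (simp add: mu_nonneg)

lemma V_append_0: "V (b * q) = V q"
  using V_append[of 0 q] base_pos by simp

lemma V_1: "V 1 = real b"
proof -
  have "V 1 = V 1 / real b + (real b - 1)"
    using V_append[of 1 0] base_ge_2 by (simp add: V_0)
  moreover have "(real b - 1) * (x - real b) = real b * (x - (x / real b + (real b - 1)))" for x
    using base_pos(2) by (simp add: field_simps)
  ultimately have "(real b - 1) * (V 1 - real b) = 0"
    by simp
  then show ?thesis using base_ge_2 by simp
qed

text \<open>For c = b - 1 the successor is b (q + 1), whose variance is V(q + 1); the formula
  persists with last term 1 - b.\<close>

lemma V_Suc_diff_append: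
  assumes "c < b"
  shows "V (Suc (b * q + c)) - V (b * q + c) = (V (Suc q) - V q) / real b + (real b - 1 - 2 * real c)"
proof (cases "Suc c < b")
  case True
  then show ?thesis
    using V_append[OF assms, of q] V_append[OF True, of q] base_pos(2)
    by (simp add: field_simps)
next
  case False
  then have c: "Suc (b * q + c) = b * Suc q" and c': "real c = real b - 1"
    using assms by auto
  show ?thesis
    unfolding c V_append_0 V_append[OF assms] unfolding c'
    using base_pos(2) by (simp add: field_simps)
qed

text \<open>The bound reproduces itself: b/b + (b - 1) = b. It is attained at r = 0.\<close>

lemma V_Suc_diff_le: "\<bar>V (Suc r) - V r\<bar> \<le> real b"
proof (induction r rule: less_induct)
  case (less r)
  show ?case
  proof (cases "r = 0")
    case True
    then show ?thesis using V_0 V_1 by simp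
  next
    case False
    define q c where "q = r div b" and "c = r mod b"
    have r: "r = b * q + c" and c: "c < b"
      using base_pos by (auto simp: q_def c_def)
    have "q < r" using False base_ge_2 by (simp add: q_def)
    from less[OF this] have "\<bar>(V (Suc q) - V q) / real b\<bar> \<le> 1"
      using base_pos(2) by (simp add: field_simps)
    moreover have "\<bar>real b - 1 - 2 * real c\<bar> \<le> real b - 1"
      using c by auto
    ultimately show ?thesis
      unfolding r V_Suc_diff_append[OF c] by linarith
  qed
qed

text \<open>The constant of \<open>exp_second_order_bound\<close> for B = b + b^2, where b bounds
  the increments of \<open>V\<close> and b^2 bounds c (b - c).\<close>

definition err_const :: real where
  "err_const = exp (2 * (real b + (real b)\<^sup>2)) * 4 * (real b + (real b)\<^sup>2) ^ 3 + (real b + (real b)\<^sup>2)\<^sup>2"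

definition gauss :: "real \<Rightarrow> real \<Rightarrow> real" where
  "gauss t v = exp (- (t\<^sup>2 * v / 2))"

lemma err_const_nonneg: "0 \<le> err_const"
  by (simp add: err_const_def)

text \<open>The Gaussians satisfy the recursion of the characteristic functions up to third order,
  because the moments of order at most two satisfy the same recursion.\<close>

lemma gauss_local_error:
  assumes "c < b" "\<bar>t\<bar> \<le> 1"
  shows "norm (of_real ((real b - real c) / real b) * cis (t * real c) * of_real (gauss t (V q))
    + of_real (real c / real b) * cis (t * (real c - real b)) * of_real (gauss t (V (Suc q)))
    - of_real (gauss t (V (b * q + c)))) \<le> err_const * \<bar>t\<bar> ^ 3"
proof -
  define B where "B = real b + (real b)\<^sup>2"
  define p p' where "p = (real b - real c) / real b" and "p' = real c / real b"
  define v where "v = V (b * q + c)"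
  \<comment> \<open>Measuring variances relative to \<open>v\<close> lets the factor
    \<open>gauss t v\<close>, which is at most 1, be pulled out of all three terms.\<close>
  define s s' where "s = v - V q" and "s' = v - V (Suc q)"
  define T :: "real \<Rightarrow> real \<Rightarrow> complex" where "T x s = 1 + \<i> * (t * x) + t\<^sup>2 * (s - x\<^sup>2) / 2" for x s
  have p: "0 \<le> p" "0 \<le> p'" "p + p' = 1"
    using assms base_pos(2) by (auto simp: p_def p'_def field_simps)
  have p1: "p * real c + p' * (real c - real b) = 0"
    using base_pos(2) by (simp add: p_def p'_def field_simps)
  have v: "v = p * V q + p' * V (Suc q) + real c * (real b - real c)"
    unfolding v_def V_append[OF assms(1)] p_def p'_def using base_pos(2) by (simp add: field_simps)
  have "p * s + p' * s' = (p + p') * v - (p * V q + p' * V (Suc q))"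
    by (simp add: s_def s'_def algebra_simps)
  also have "\<dots> = real c * (real b - real c)"
    using v p(3) by simp
  also have "\<dots> = p * (real c)\<^sup>2 + p' * (real c - real b)\<^sup>2"
    using base_pos(2) by (simp add: p_def p'_def field_simps power2_eq_square)
  finally have p2: "p * (s - (real c)\<^sup>2) + p' * (s' - (real c - real b)\<^sup>2) = 0"
    by (simp add: algebra_simps)
  have cb: "0 \<le> real c * (real b - real c)" "real c * (real b - real c) \<le> (real b)\<^sup>2"
    using assms(1) by (auto simp: power2_eq_square intro: mult_mono)
  define D where "D = V (Suc q) - V q"
  have D: "\<bar>D\<bar> \<le> real b" unfolding D_def by (rule V_Suc_diff_le)
  have "\<bar>p' * D\<bar> \<le> 1 * real b" "\<bar>p * D\<bar> \<le> 1 * real b"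
    unfolding abs_mult using p D by (intro mult_mono; simp)+
  moreover have "s = p' * D + real c * (real b - real c)"
  proof -
    have "s = p * V q + p' * V (Suc q) + real c * (real b - real c) - (p + p') * V q"
      using v p(3) by (simp add: s_def)
    then show ?thesis by (simp add: D_def algebra_simps)
  qed
  moreover have "s' = - (p * D) + real c * (real b - real c)"
  proof -
    have "s' = p * V q + p' * V (Suc q) + real c * (real b - real c) - (p + p') * V (Suc q)"
      using v p(3) by (simp add: s'_def)
    then show ?thesis by (simp add: D_def algebra_simps)
  qed
  ultimately have s: "\<bar>s\<bar> \<le> B" "\<bar>s'\<bar> \<le> B"
    using cb unfolding B_def by linarith+
  have x: "\<bar>real c\<bar> \<le> B" "\<bar>real c - real b\<bar> \<le> B"
    using assms(1) zero_le_power2[of "real b"] unfolding B_def by linarith+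
  define z z' :: complex
    where "z = \<i> * (t * real c) + t\<^sup>2 * s / 2" and "z' = \<i> * (t * (real c - real b)) + t\<^sup>2 * s' / 2"
  have K: "norm (exp z - T (real c) s) \<le> err_const * \<bar>t\<bar> ^ 3"
    "norm (exp z' - T (real c - real b) s') \<le> err_const * \<bar>t\<bar> ^ 3"
    using exp_second_order_bound[OF assms(2) x(1) s(1)] exp_second_order_bound[OF assms(2) x(2) s(2)]
    unfolding T_def z_def z'_def err_const_def B_def by simp_all
  \<comment> \<open>The two Taylor polynomials average to exactly 1: the first-order terms cancel by
    \<open>p1\<close>, the second-order terms by \<open>p2\<close>.\<close>
  have "p * T (real c) s + p' * T (real c - real b) s' =
     of_real (p + p') + \<i> * t * of_real (p * real c + p' * (real c - real b)) +
     t\<^sup>2 / 2 * of_real (p * (s - (real c)\<^sup>2) + p' * (s' - (real c - real b)\<^sup>2))"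
    by (simp add: T_def algebra_simps add_divide_distrib diff_divide_distrib)
  then have T: "p * T (real c) s + p' * T (real c - real b) s' = 1"
    using p(3) p1 p2 by simp
  have g: "cis (t * real c) * of_real (gauss t (V q)) = of_real (gauss t v) * exp z"
    "cis (t * (real c - real b)) * of_real (gauss t (V (Suc q))) = of_real (gauss t v) * exp z'"
    by (simp_all add: gauss_def cis_conv_exp z_def z'_def s_def s'_def algebra_simps
        diff_divide_distrib flip: exp_of_real exp_add)
  have "p * cis (t * real c) * gauss t (V q) + p' * cis (t * (real c - real b)) * gauss t (V (Suc q)) - gauss t v
     = of_real (gauss t v) * (p * exp z + p' * exp z' - 1)"
    unfolding mult.assoc g by (simp add: algebra_simps)
  also have "\<dots> = of_real (gauss t v) * (p * (exp z - T (real c) s) + p' * (exp z' - T (real c - real b) s'))"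
    unfolding T[symmetric] by (simp add: algebra_simps)
  also have "norm \<dots> \<le> 1 * (p * (err_const * \<bar>t\<bar> ^ 3) + p' * (err_const * \<bar>t\<bar> ^ 3))"
    unfolding norm_mult
  proof (rule mult_mono)
    show "norm (complex_of_real (gauss t v)) \<le> 1"
      by (simp add: gauss_def v_def V_nonneg)
    show "norm (p * (exp z - T (real c) s) + p' * (exp z' - T (real c - real b) s'))
        \<le> p * (err_const * \<bar>t\<bar> ^ 3) + p' * (err_const * \<bar>t\<bar> ^ 3)"
      using p K by (intro norm_triangle_mono) (auto simp: norm_mult intro!: mult_left_mono)
  qed auto
  also have "\<dots> = err_const * \<bar>t\<bar> ^ 3"
    using p(3) by (simp flip: distrib_right)
  finally show ?thesis by (simp add: p_def p'_def v_def)
qed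

text \<open>Subtract the recursion of \<open>phi\<close> from the approximate one of the Gaussians.
  The phases have modulus 1, so errors are only averaged.\<close>

lemma phi_gauss_step:
  assumes "c < b" "\<bar>t\<bar> \<le> 1"
  defines "e \<equiv> (\<lambda>r. norm (phi r t - of_real (gauss t (V r))))"
  shows "e (b * q + c) \<le> ((real b - real c) * e q + real c * e (Suc q)) / real b + err_const * \<bar>t\<bar> ^ 3"
proof -
  define L where "L = of_real ((real b - real c) / real b) * cis (t * real c) * of_real (gauss t (V q))
    + of_real (real c / real b) * cis (t * (real c - real b)) * of_real (gauss t (V (Suc q)))
    - of_real (gauss t (V (b * q + c)))"
  have "phi (b * q + c) t - of_real (gauss t (V (b * q + c))) =
    (of_real ((real b - real c) / real b) * cis (t * real c) * (phi q t - of_real (gauss t (V q)))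
    + of_real (real c / real b) * cis (t * (real c - real b)) * (phi (Suc q) t - of_real (gauss t (V (Suc q))))) + L"
    unfolding L_def phi_append[OF assms(1)] by (simp only: algebra_simps)
  also have "norm \<dots> \<le> ((real b - real c) / real b * e q + real c / real b * e (Suc q)) + err_const * \<bar>t\<bar> ^ 3"
  proof (intro norm_triangle_mono)
    show "norm L \<le> err_const * \<bar>t\<bar> ^ 3"
      unfolding L_def by (rule gauss_local_error[OF assms(1,2)])
  qed (use assms(1) in \<open>simp_all add: norm_mult e_def norm_divide del: of_real_divide of_real_diff\<close>)
  finally show ?thesis by (simp add: e_def add_divide_distrib)
qed

lemma phi_gauss_bound:
  assumes "\<bar>t\<bar> \<le> 1"
  shows "norm (phi r t - of_real (gauss t (V r))) \<le> err_const * \<bar>t\<bar> ^ 3 * V r"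
proof -
  define K where "K = err_const * \<bar>t\<bar> ^ 3"
  have K: "0 \<le> K" by (simp add: K_def err_const_nonneg)
  define e where "e r = norm (phi r t - of_real (gauss t (V r)))" for r
  have e_step: "e (b * q + c) \<le> ((real b - real c) * e q + real c * e (Suc q)) / real b + K" if "c < b" for q c
    unfolding e_def K_def using phi_gauss_step[OF that assms] .
  have e_0: "e 0 = 0" by (simp add: e_def phi_0 V_0 gauss_def)
  have "e r \<le> K * V r"
  proof (induction r rule: base_induct)
    case zero
    then show ?case by (simp add: e_0 V_0)
  next
    case one
    \<comment> \<open>Here \<open>e 1\<close> occurs on both sides. Since b \<ge> 2 it can be
      absorbed, leaving 2 K, which is at most K b = K V(1).\<close>
    have "e 1 \<le> e 1 / real b + K"
      using e_step[of 1 0] base_ge_2 by (simp add: e_0)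
    moreover have "e 1 / real b \<le> e 1 / 2"
      using base_ge_2 by (intro divide_left_mono) (auto simp: e_def)
    ultimately have "e 1 \<le> K * 2" by linarith
    also have "\<dots> \<le> K * real b" using K base_ge_2 by (intro mult_left_mono) auto
    finally show ?case unfolding V_1 .
  next
    case (step q c)
    show ?case
    proof (cases "c = 0")
      case True
      \<comment> \<open>A digit 0 leaves the variance unchanged, so nothing could pay for a local
        error; the error is carried over exactly.\<close>
      have "phi (b * q) t = phi q t"
        using phi_append[of 0 q t] base_pos by simp
      then show ?thesis using True step by (simp add: e_def V_append_0)
    next
      case False
      have "1 * 1 \<le> real c * (real b - real c)"
        using False step(1) by (intro mult_mono) auto
      then have "K * 1 \<le> K * (real c * (real b - real c))"
        using K by (intro mult_left_mono) auto
      moreover have "((real b - real c) * e q + real c * e (Suc q)) / real b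
          \<le> ((real b - real c) * (K * V q) + real c * (K * V (Suc q))) / real b"
        using step False by (intro divide_right_mono add_mono mult_left_mono) auto
      ultimately have "e (b * q + c) \<le> ((real b - real c) * (K * V q) + real c * (K * V (Suc q))) / real b
          + K * (real c * (real b - real c))"
        using e_step[OF step(1), of q]
        by linarith
      also have "\<dots> = K * V (b * q + c)"
        unfolding V_append[OF step(1)] by (simp add: algebra_simps)
      finally show ?thesis .
    qed
  qed
  then show ?thesis by (simp add: e_def K_def)
qed

end

subsection \<open>Variance and the number of blocks\<close>

context digit_base
begin

section \<open>Block count and variance, digit by digit\<close>

lemma digits_append: "c < b \<Longrightarrow> 0 < b * q + c \<Longrightarrow> digits b (b * q + c) = c # digits b q"
  using base_ge_2 digits.simps[of b "b * q + c"] by simp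

lemma rho_small:
  assumes "c < b"
  shows "rho b c \<le> 1"
proof (cases "c = 0")
  case True
  then show ?thesis by (simp add: rho_def digits.simps)
next
  case False
  then have "digits b c = [c]"
    using digits_append[OF assms, of 0] by (simp add: digits.simps[of b 0])
  then have "rho b c \<le> card {0 :: nat}"
    unfolding rho_def Let_def by (intro card_mono) auto
  then show ?thesis by simp
qed

text \<open>Digits are listed from the least significant, so c becomes position 0 and all others
  move up by one. Only the old position 0, now position 1, can change its status as a block start;
  \<open>Y\<close> records it.\<close>

lemma rho_append_le:
  assumes "c < b" "0 < q"
  shows "rho b (b * q + c) \<le> rho b q +
    (if dclass b (q mod b) \<noteq> dclass b c \<or> dclass b (q mod b) = 2 then 1 else 0)"
proof -
  define X where "X ds = {i. i < length ds \<and> (i = 0 \<or> dclass b (ds ! i) \<noteq> dclass b (ds ! (i - 1))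
    \<or> dclass b (ds ! i) = 2)}" for ds
  define Y where "Y = (if dclass b (q mod b) \<noteq> dclass b c \<or> dclass b (q mod b) = 2 then {1 :: nat} else {})"
  have rho: "rho b r = card (X (digits b r))" for r
    by (simp add: rho_def X_def Let_def)
  have fin: "finite (X ds)" for ds by (simp add: X_def)
  have q: "digits b q = q mod b # digits b (q div b)"
    using assms base_ge_2 by (subst digits.simps) auto
  have "digits b (b * q + c) = c # digits b q"
    using assms base_pos by (intro digits_append) auto
  moreover have "X (c # digits b q) \<subseteq> insert 0 (Suc ` (X (digits b q) - {0})) \<union> Y"
  proof
    fix i assume i: "i \<in> X (c # digits b q)"
    show "i \<in> insert 0 (Suc ` (X (digits b q) - {0})) \<union> Y"
    proof (cases i)
      case (Suc j)
      show ?thesis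
      proof (cases j)
        case 0
        then show ?thesis using i Suc q by (auto simp: X_def Y_def)
      next
        case (Suc k)
        then have "j \<in> X (digits b q) - {0}"
          using i \<open>i = Suc j\<close> by (auto simp: X_def)
        then show ?thesis using \<open>i = Suc j\<close> by auto
      qed
    qed simp
  qed
  ultimately have "rho b (b * q + c) \<le> card (insert 0 (Suc ` (X (digits b q) - {0})) \<union> Y)"
    unfolding rho by (simp only:) (intro card_mono, auto simp: fin Y_def)
  also have "\<dots> \<le> card (insert 0 (Suc ` (X (digits b q) - {0}))) + card Y"
    by (rule card_Un_le)
  also have "card (insert 0 (Suc ` (X (digits b q) - {0}))) = Suc (card (X (digits b q) - {0}))"
    by (subst card_insert_disjoint) (auto simp: fin card_image)
  also have "\<dots> = rho b q"
    unfolding rho by (rule card_Suc_Diff1[OF fin]) (simp add: X_def q)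
  also have "card Y = (if dclass b (q mod b) \<noteq> dclass b c \<or> dclass b (q mod b) = 2 then 1 else 0)"
    unfolding Y_def by (simp only: if_distrib[of card] card.empty card_1_singleton_iff) simp
  finally show ?thesis .
qed

text \<open>Only the minimum over both successors of the recursion is monotone under appending digits.\<close>

definition V_min :: "nat \<Rightarrow> real" where
  "V_min r = min (V r) (V (Suc r))"

lemma V_min_nonneg: "0 \<le> V_min r"
  by (simp add: V_min_def V_nonneg)

lemma V_append_ge:
  assumes "0 < c" "c < b"
  shows "V_min q + (real b - 1) \<le> V (b * q + c)"
proof -
  have "(real b - real c) * V_min q + real c * V_min q \<le> (real b - real c) * V q + real c * V (Suc q)"
    using assms by (intro add_mono mult_left_mono) (auto simp: V_min_def)
  then have "real b * V_min q \<le> (real b - real c) * V q + real c * V (Suc q)"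
    by (simp add: algebra_simps)
  then have "V_min q \<le> ((real b - real c) * V q + real c * V (Suc q)) / real b"
    using base_pos(2) by (simp add: field_simps)
  \<comment> \<open>This product equals c (b - c) - (b - 1).\<close>
  moreover have "0 \<le> (real c - 1) * (real b - 1 - real c)"
    using assms by (intro mult_nonneg_nonneg) auto
  then have "real b - 1 \<le> real c * (real b - real c)"
    by (simp add: algebra_simps)
  ultimately show ?thesis
    unfolding V_append[OF assms(2)] by linarith
qed

text \<open>Both c and c + 1 are nonzero digits, so a number and its successor gain alike.\<close>

lemma V_min_append_middle:
  assumes "0 < c" "Suc c < b"
  shows "V_min q + (real b - 1) \<le> V_min (b * q + c)"
  using V_append_ge[of c q] V_append_ge[of "Suc c" q] assms by (simp add: V_min_def)

lemma V_min_append_ge: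
  assumes "c < b"
  shows "V_min q \<le> V_min (b * q + c)"
proof -
  have b: "0 \<le> real b - 1" using base_ge_2 by simp
  have "V_min q \<le> V (b * q + c)"
    using V_append_ge[of c q] assms b V_append_0[of q] by (cases "c = 0") (auto simp: V_min_def)
  moreover have "V_min q \<le> V (Suc (b * q + c))"
  proof (cases "Suc c = b")
    case True
    then have "Suc (b * q + c) = b * Suc q" by auto
    then show ?thesis by (simp only: V_append_0) (simp add: V_min_def)
  next
    case False
    then show ?thesis using V_append_ge[of "Suc c" q] assms b by simp
  qed
  ultimately show ?thesis by (simp add: V_min_def)
qed

text \<open>A single digit 0 gives no gain to the number, a single b - 1 none to its successor.
  Across a block boundary both gain: after b - 1, 0 through the digits b - 1 and 1, after 0, b - 1
  through b - 1 and, following a carry, 1. A middle digit c' gains by itself.\<close>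

lemma V_min_append_two:
  assumes "c < b" "c' < b" "dclass b c' \<noteq> dclass b c \<or> dclass b c' = 2"
    and "dclass b c \<noteq> 2"
  shows "V_min q + (real b - 1) \<le> V_min (b * (b * q + c') + c)"
proof -
  consider "0 < c'" "Suc c' < b" | "c' = b - 1" "c = 0" | "c' = 0" "c = b - 1"
    using assms by (auto simp: dclass_def split: if_splits)
  then show ?thesis
  proof cases
    case 1
    then show ?thesis
      using V_min_append_middle[of c' q] V_min_append_ge[OF assms(1), of "b * q + c'"] by linarith
  next
    case 2
    have "V_min q + (real b - 1) \<le> V (b * (b * q + c') + c)"
      using 2 V_append_ge[of c' q] base_ge_2 by (simp add: V_append_0)
    moreover have "V_min q + (real b - 1) \<le> V (Suc (b * (b * q + c') + c))"
      using 2 V_append_ge[of 1 "b * q + c'"] V_min_append_ge[OF assms(2), of q] base_ge_2 by simp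
    ultimately show ?thesis by (simp add: V_min_def)
  next
    case 3
    have "V_min q + (real b - 1) \<le> V (b * (b * q + c') + c)"
      using V_append_ge[of c "b * q + c'"] V_min_append_ge[OF assms(2), of q] 3 base_ge_2 by simp
    moreover have "Suc (b * (b * q + c') + c) = b * (b * q + 1)"
      using 3 base_ge_2 by simp
    then have "V_min q + (real b - 1) \<le> V (Suc (b * (b * q + c') + c))"
      using V_append_ge[of 1 q] base_ge_2 by (simp only: V_append_0)
    ultimately show ?thesis by (simp add: V_min_def)
  qed
qed

text \<open>Without a new block monotonicity suffices. A middle digit adds at most one block and
  gains b - 1 \<ge> 1. Otherwise two digits are stripped: at most two blocks for one gain, hence the
  factor 2. The additive 2 covers numbers of at most two digits.\<close>

lemma rho_le_V_min: "real (rho b r) \<le> 2 * V_min r + 2"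
proof (induction r rule: less_induct)
  case (less r)
  have b: "1 \<le> real b - 1" using base_ge_2 by simp
  define q c where "q = r div b" and "c = r mod b"
  have r: "r = b * q + c" and c: "c < b"
    using base_pos by (auto simp: q_def c_def)
  show ?case
  proof (cases "q = 0")
    case True
    then have "rho b r \<le> 1" using rho_small[OF c] r by simp
    then show ?thesis using V_min_nonneg[of r] by linarith
  next
    case False
    then have "q < r" using base_ge_2 by (cases r) (auto simp: q_def)
    note IH = less[OF this]
    define c' q' where "c' = q mod b" and "q' = q div b"
    have q: "q = b * q' + c'" and c': "c' < b"
      using base_pos by (auto simp: q'_def c'_def)
    note le = rho_append_le[OF c, of q, folded r c'_def]
    show ?thesis
    proof (cases "dclass b c' \<noteq> dclass b c \<or> dclass b c' = 2")
      case False
      then have "rho b r \<le> rho b q" using le \<open>q \<noteq> 0\<close> by simp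
      then show ?thesis using IH V_min_append_ge[OF c, of q, folded r] by linarith
    next
      case new: True
      then have le1: "rho b r \<le> rho b q + 1" using le \<open>q \<noteq> 0\<close> by simp
      show ?thesis
      proof (cases "dclass b c = 2")
        case True
        then have "0 < c" "Suc c < b" using c by (auto simp: dclass_def split: if_splits)
        from V_min_append_middle[OF this, of q, folded r] show ?thesis
          using IH le1 b by linarith
      next
        case False
        show ?thesis
        proof (cases "q' = 0")
          case True
          then have "rho b q \<le> 1" using rho_small[OF c'] q by simp
          then show ?thesis using le1 V_min_nonneg[of r] by linarith
        next
          case q': False
          then have "q' < r" using \<open>q < r\<close> by (simp add: q'_def) (metis div_le_dividend le_less_trans)
          have "rho b q \<le> rho b q' + 1"
            using rho_append_le[OF c', of q', folded q] q' by (auto split: if_splits)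
          then show ?thesis
            using le1 less[OF \<open>q' < r\<close>] V_min_append_two[OF c c' new False, of q', folded q r] b
            by linarith
        qed
      qed
    qed
  qed
qed

lemma rho_le_V: "real (rho b r) \<le> 2 * V r + 2"
  using rho_le_V_min[of r] by (simp add: V_min_def)

subsection \<open>Weak convergence\<close>

text \<open>Absolute summability identifies the Bochner integral with the unordered sum in
  \<open>mean\<close>.\<close>

lemma integral_mu_density:
  fixes f :: "int \<Rightarrow> 'a::{banach,second_countable_topology}"
  assumes "quad_bounded f"
  shows "integral\<^sup>L (density (count_space UNIV) (\<lambda>d. ennreal (mu b r d))) f = mean r f"
proof -
  have "integral\<^sup>L (density (count_space UNIV) (\<lambda>d. ennreal (mu b r d))) f
      = infsetsum (\<lambda>d. mu b r d *\<^sub>R f d) UNIV"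
    by (simp add: integral_density mu_nonneg infsetsum_def)
  also have "\<dots> = mean r f"
    unfolding mean_def
    by (intro infsetsum_infsum abs_summable_equivalent[THEN iffD1] abs_summable_mu assms)
  finally show ?thesis .
qed

lemma prob_space_mu_density: "prob_space (density (count_space UNIV) (\<lambda>d. ennreal (mu b r d)))"
proof
  have "Infinite_Set_Sum.abs_summable_on (\<lambda>d. mu b r d *\<^sub>R (1 :: real)) UNIV"
    by (intro abs_summable_equivalent[THEN iffD1] abs_summable_mu quad_bounded_const)
  then have int: "integrable (count_space UNIV) (mu b r)"
    by (simp add: abs_summable_on_def)
  have "emeasure (density (count_space UNIV) (\<lambda>d. ennreal (mu b r d))) UNIV
      = (\<integral>\<^sup>+ d. ennreal (mu b r d) \<partial>count_space UNIV)"
    by (simp add: emeasure_density)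
  also have "\<dots> = ennreal (integral\<^sup>L (count_space UNIV) (mu b r))"
    by (rule nn_integral_eq_integral[OF int]) (simp add: mu_nonneg)
  also have "integral\<^sup>L (count_space UNIV) (mu b r) = mean r (\<lambda>d. 1 :: real)"
    using integral_mu_density[OF quad_bounded_const[of "1 :: real"], of r]
    by (subst (asm) integral_density) (simp_all add: mu_nonneg)
  finally show "emeasure (density (count_space UNIV) (\<lambda>d. ennreal (mu b r d)))
      (space (density (count_space UNIV) (\<lambda>d. ennreal (mu b r d)))) = 1"
    by (simp add: mean_const_1)
qed

lemma real_distribution_mu_tilde: "real_distribution (mu_tilde b r)"
  unfolding mu_tilde_def real_distribution_def real_distribution_axioms_def
  by (auto intro!: prob_space.prob_space_distr prob_space_mu_density)

lemma char_mu_tilde: "char (mu_tilde b r) t = phi r (t / sigma b r)"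
proof -
  have "char (mu_tilde b r) t = integral\<^sup>L (density (count_space UNIV) (\<lambda>d. ennreal (mu b r d)))
     (\<lambda>d. cis (t / sigma b r * real_of_int d))"
    unfolding char_def mu_tilde_def
    by (subst integral_distr) (auto simp: cis_conv_exp mult_ac)
  then show ?thesis
    by (simp only: integral_mu_density[OF quad_bounded_cis] phi_def)
qed

text \<open>\<open>phi_gauss_bound\<close> at t / sqrt V: the factor V^(-3/2) from the cube meets V,
  leaving V^(-1/2).\<close>

lemma char_mu_tilde_bound:
  assumes "0 < V r" "\<bar>t\<bar> \<le> sqrt (V r)"
  shows "norm (char (mu_tilde b r) t - of_real (exp (- t\<^sup>2 / 2))) \<le> err_const * \<bar>t\<bar> ^ 3 / sqrt (V r)"
proof -
  have s: "sigma b r = sqrt (V r)" by (simp add: sigma_def Var_mu_eq)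
  have "\<bar>t / sqrt (V r)\<bar> \<le> 1" using assms by (simp add: field_simps)
  from phi_gauss_bound[OF this, of r]
  have "norm (char (mu_tilde b r) t - of_real (gauss (t / sqrt (V r)) (V r)))
      \<le> err_const * \<bar>t / sqrt (V r)\<bar> ^ 3 * V r"
    by (simp add: char_mu_tilde s)
  moreover have "gauss (t / sqrt (V r)) (V r) = exp (- t\<^sup>2 / 2)"
    using assms(1) by (simp add: gauss_def power_divide)
  moreover have "err_const * \<bar>t / sqrt (V r)\<bar> ^ 3 * V r = err_const * \<bar>t\<bar> ^ 3 / sqrt (V r)"
  proof -
    have "\<bar>t / sqrt (V r)\<bar> ^ 3 * (sqrt (V r))\<^sup>2 = \<bar>t\<bar> ^ 3 / sqrt (V r)"
      using assms(1) by (simp add: power_divide eval_nat_numeral)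
    then show ?thesis using assms(1) by (simp add: mult.assoc)
  qed
  ultimately show ?thesis by simp
qed

end

theorem theorem2:
  fixes b :: nat and r :: "nat \<Rightarrow> nat"
  assumes "b \<ge> 2"
    and "\<And>n. r n \<ge> 1"
    and "filterlim (\<lambda>n. rho b (r n)) at_top sequentially"
  shows "weak_conv_m (\<lambda>n. mu_tilde b (r n)) (density lborel std_normal_density)"
proof -
  interpret digit_base b
    by unfold_locales (rule assms(1))
  have V: "filterlim (\<lambda>n. V (r n)) at_top sequentially"
  proof (rule filterlim_at_top_mono)
    have "filterlim (\<lambda>n. real (rho b (r n))) at_top sequentially"
      by (rule filterlim_compose[OF filterlim_real_sequentially assms(3)])
    then have "filterlim (\<lambda>n. - 1 + real (rho b (r n)) * (1 / 2)) at_top sequentially"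
      by (intro filterlim_tendsto_add_at_top[OF tendsto_const]
          filterlim_at_top_mult_tendsto_pos[OF tendsto_const]) auto
    then show "filterlim (\<lambda>n. - 1 + real (rho b (r n)) / 2) at_top sequentially"
      by simp
    show "\<forall>\<^sub>F n in sequentially. - 1 + real (rho b (r n)) / 2 \<le> V (r n)"
      using rho_le_V by (intro always_eventually allI) (smt (verit) field_sum_of_halves)
  qed
  then have sqrtV: "filterlim (\<lambda>n. sqrt (V (r n))) at_top sequentially"
    by (rule filterlim_compose[OF sqrt_at_top])
  show ?thesis
  proof (rule levy_continuity[OF real_distribution_mu_tilde real_dist_normal_dist])
    fix t
    have "(\<lambda>n. char (mu_tilde b (r n)) t - of_real (exp (- t\<^sup>2 / 2))) \<longlonglongrightarrow> 0"
    proof (rule Lim_null_comparison)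
      \<comment> \<open>For fixed \<open>t\<close>, the conditions 0 < V and |t| \<le> sqrt V hold
        for all large n.\<close>
      show "\<forall>\<^sub>F n in sequentially. norm (char (mu_tilde b (r n)) t - of_real (exp (- t\<^sup>2 / 2)))
          \<le> err_const * \<bar>t\<bar> ^ 3 / sqrt (V (r n))"
        using filterlim_at_top_dense[THEN iffD1, OF V, rule_format, of 0]
          filterlim_at_top[THEN iffD1, OF sqrtV, rule_format, of "\<bar>t\<bar>"]
        by eventually_elim (rule char_mu_tilde_bound)
      show "(\<lambda>n. err_const * \<bar>t\<bar> ^ 3 / sqrt (V (r n))) \<longlonglongrightarrow> 0"
        by (rule real_tendsto_divide_at_top[OF tendsto_const sqrtV])
    qed
    then show "(\<lambda>n. char (mu_tilde b (r n)) t) \<longlonglongrightarrow> char std_normal_distribution t"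
      by (simp add: char_std_normal_distribution LIM_zero_iff)
  qed
qed

end
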